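(* For any non-complete graph $G$ with order $n$ and independence number $\alpha=\alpha(G)$, $\mathrm{gp}(\mathcal{M}(G))\leq n+\alpha-1$.
   Context: All graphs are simple, connected and finite. A set $S$ of vertices of a graph $H$ is a general position set if no shortest path in $H$ contains three or more vertices of $S$; $\mathrm{gp}(H)$ is the number of vertices in a largest general position set of $H$. The Mycielskian $\mathcal{M}(G)$ of a graph $G$ with vertex set $V$ and edge set $E$ has vertex set $V\cup V'\cup\{u^*\}$, where $V'=\{u' : u\in V\}$ is a disjoint copy of $V$ and $u^*$ is an additional vertex (the root), and edge set $E\cup\{uv' : uv\in E\}\cup\{v'u^* : v'\in V'\}$ (for each edge $uv\in E$ both $uv'$ and $vu'$ are included). *)

theory Defs
  imports "Graph_Theory.Graph_Theory"
begin

text \<open>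
  Finite simple graphs are symmetric loop-free pair digraphs (\<open>pair_graph\<close>), each edge being
  represented by its two orientations. \<open>Digraph_Component.connected\<close> includes non-emptiness.
\<close>

definition shortest_path :: "('a,'b) pre_digraph \<Rightarrow> 'a vwalk \<Rightarrow> bool" where
  "shortest_path H p \<longleftrightarrow> vpath p H \<and>
     (\<forall>q. vpath q H \<and> hd q = hd p \<and> last q = last p \<longrightarrow> vwalk_length p \<le> vwalk_length q)"

definition general_position_set :: "('a,'b) pre_digraph \<Rightarrow> 'a set \<Rightarrow> bool" where
  "general_position_set H S \<longleftrightarrow> S \<subseteq> verts H \<and>
     \<not> (\<exists>p. shortest_path H p \<and> 3 \<le> card (set p \<inter> S))"

definition gp :: "('a,'b) pre_digraph \<Rightarrow> nat" where
  "gp H = Max (card ` {S. general_position_set H S})"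

definition independent_set :: "('a,'b) pre_digraph \<Rightarrow> 'a set \<Rightarrow> bool" where
  "independent_set G S \<longleftrightarrow> S \<subseteq> verts G \<and> (\<forall>u\<in>S. \<forall>v\<in>S. \<not> u \<rightarrow>\<^bsub>G\<^esub> v)"

definition independence_number :: "('a,'b) pre_digraph \<Rightarrow> nat" where
  "independence_number G = Max (card ` {S. independent_set G S})"

datatype 'a mycielskian_vertex = Orig 'a | Copy 'a | Root

definition mycielskian :: "'a pair_pre_digraph \<Rightarrow> 'a mycielskian_vertex pair_pre_digraph" where
  "mycielskian G = \<lparr>
     pverts = Orig ` pverts G \<union> Copy ` pverts G \<union> {Root},
     parcs = {(Orig u, Orig v) | u v. (u, v) \<in> parcs G}
       \<union> {(Orig u, Copy v) | u v. (u, v) \<in> parcs G}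
       \<union> {(Copy u, Orig v) | u v. (u, v) \<in> parcs G}
       \<union> {(Copy v, Root) | v. v \<in> pverts G}
       \<union> {(Root, Copy v) | v. v \<in> pverts G} \<rparr>"

lemma pair_graph_mycielskian:
  assumes "pair_graph G"
  shows "pair_graph (mycielskian G)"
proof -
  interpret pair_graph G by fact
  have fin: "finite (pverts (mycielskian G))"
    by (simp add: mycielskian_def)
  have sub: "parcs (mycielskian G) \<subseteq> pverts (mycielskian G) \<times> pverts (mycielskian G)"
    by (auto simp: mycielskian_def dest: in_arcsD1 in_arcsD2)
  have sym: "sym (parcs (mycielskian G))"
    using arcs_ends_symmetric[OF sym_arcs] by (auto simp: mycielskian_def sym_def)
  have irr: "(x, x) \<notin> parcs (mycielskian G)" for x
    using no_loops by (fastforce simp: mycielskian_def)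
  show ?thesis
  proof
    show "finite (parcs (mycielskian G))"
      using sub fin by (meson finite_SigmaI finite_subset)
    show "symmetric (with_proj (mycielskian G))"
      using sym by (simp add: symmetric_def)
  qed (use fin sub irr in \<open>auto simp: mem_Times_iff\<close>)
qed

end

theory Submission
  imports Defs
begin

text \<open>
  Let \<open>S\<close> be a general position set of the Mycielskian, let \<open>A\<close> and \<open>B\<close> be the sets of vertices \<open>v\<close>
  of \<open>G\<close> whose original and whose copy, respectively, lie in \<open>S\<close>, and write \<open>v'\<close> for the copy of
  \<open>v\<close>. The proof only uses geodesics of length two and three, which can be recognised locally: a
  path of length two is shortest iff its ends are distinct and not adjacent, and a path of length
  three with distinct non-adjacent ends is shortest iff these have no common neighbour.

  If the root lies in \<open>S\<close>, then at most one copy does, because any two copies are joined by a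
  geodesic through the root. Moreover \<open>A\<close> is not everything: a connected non-complete graph
  contains an induced path on three vertices, and this path remains a geodesic in the Mycielskian.
  Hence \<open>S\<close> has at most \<open>1 + 1 + (n - 1) = n + 1\<close> elements, and \<open>\<alpha> \<ge> 2\<close> as \<open>G\<close> is not complete.

  If the root does not lie in \<open>S\<close>, then \<open>S\<close> has \<open>card (A \<union> B) + card (A \<inter> B)\<close> elements. An edge
  \<open>uv\<close> with \<open>u \<in> A \<inter> B\<close> and \<open>v \<in> A\<close> would give the geodesic \<open>u, v, u'\<close>; so \<open>A \<inter> B\<close> is independent,
  and the bound \<open>n + \<alpha>\<close> follows. It remains to exclude that \<open>A \<union> B\<close> is everything and
  \<open>C = A \<inter> B\<close> is a maximum independent set. In that case every vertex outside \<open>C\<close> has a neighbour in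
  \<open>C\<close> and therefore cannot be in \<open>A\<close>, so that \<open>A = C\<close> and \<open>B\<close> is everything. The geodesics
  \<open>v', x, w'\<close> with \<open>x \<in> C\<close> show that the vertices of \<open>C\<close> are leaves of \<open>G\<close>. Take such a leaf \<open>x\<close>
  with neighbour \<open>y\<close>. As \<open>C\<close> has a second element, \<open>G\<close> is larger than the edge \<open>xy\<close>, so \<open>y\<close> has
  another neighbour \<open>w\<close>. Either \<open>w \<in> C\<close>, and \<open>x, y', w\<close> is a geodesic with three
  vertices in \<open>S\<close>; or \<open>w\<close> is adjacent to another leaf \<open>z \<in> C\<close>, and \<open>x, y', w, z\<close> is such a geodesic.
\<close>

section \<open>Short geodesics and general position\<close>

lemma shortest_path_length_2:
  assumes "wf_digraph H" "a \<rightarrow>\<^bsub>H\<^esub> b" "b \<rightarrow>\<^bsub>H\<^esub> c" "distinct [a, b, c]" "\<not> a \<rightarrow>\<^bsub>H\<^esub> c"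
  shows "shortest_path H [a, b, c]"
proof -
  interpret wf_digraph H by fact
  have "vpath [a, b, c] H"
    using assms by (auto simp: vpath_def vwalk_def)
  moreover have "2 \<le> length q - 1" if "vpath q H" "hd q = a" "last q = c" for q
  proof (rule ccontr)
    assume "\<not> ?thesis"
    with that have "\<exists>x. q = [x] \<or> (\<exists>y. q = [x, y])"
      by (cases q rule: vwalk_arcs.cases; cases "tl (tl q)") (auto simp: vpath_def vwalk_def)
    with that assms show False
      by (auto simp: vpath_def vwalk_def)
  qed
  ultimately show ?thesis
    by (auto simp: shortest_path_def numeral_2_eq_2)
qed

lemma shortest_path_length_3:
  assumes "wf_digraph H" "a \<rightarrow>\<^bsub>H\<^esub> b" "b \<rightarrow>\<^bsub>H\<^esub> c" "c \<rightarrow>\<^bsub>H\<^esub> d" "distinct [a, b, c, d]"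
    and "\<not> a \<rightarrow>\<^bsub>H\<^esub> d" "\<And>x. a \<rightarrow>\<^bsub>H\<^esub> x \<Longrightarrow> x \<rightarrow>\<^bsub>H\<^esub> d \<Longrightarrow> False"
  shows "shortest_path H [a, b, c, d]"
proof -
  interpret wf_digraph H by fact
  have "vpath [a, b, c, d] H"
    using assms by (auto simp: vpath_def vwalk_def)
  moreover have "3 \<le> length q - 1" if "vpath q H" "hd q = a" "last q = d" for q
  proof (rule ccontr)
    assume "\<not> ?thesis"
    with that have "\<exists>x. q = [x] \<or> (\<exists>y. q = [x, y] \<or> (\<exists>z. q = [x, y, z]))"
      by (cases q rule: vwalk_arcs.cases; cases "tl (tl q)"; cases "tl (tl (tl q))")
        (auto simp: vpath_def vwalk_def)
    with that assms show False
      by (auto simp: vpath_def vwalk_def)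
  qed
  ultimately show ?thesis
    by (auto simp: shortest_path_def numeral_3_eq_3)
qed

lemma general_position_setD:
  assumes "general_position_set H S" "shortest_path H p" "T \<subseteq> set p" "T \<subseteq> S" "card T = 3"
  shows False
proof -
  have "card T \<le> card (set p \<inter> S)"
    using assms by (intro card_mono) auto
  with assms show False
    by (auto simp: general_position_set_def)
qed

lemma gp_leI:
  assumes "finite (verts H)" and "\<And>S. general_position_set H S \<Longrightarrow> card S \<le> k"
  shows "gp H \<le> k"
proof -
  have "finite {S. general_position_set H S}"
    by (rule finite_subset[of _ "Pow (verts H)"])
      (use assms(1) in \<open>auto simp: general_position_set_def\<close>)
  moreover have "general_position_set H {}"
    by (simp add: general_position_set_def)
  ultimately show ?thesis
    unfolding gp_def using assms(2) by (subst Max_le_iff) auto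
qed

lemma card_le_independence_number:
  assumes "finite (verts G)" "independent_set G S"
  shows "card S \<le> independence_number G"
proof -
  have "finite {S. independent_set G S}"
    by (rule finite_subset[of _ "Pow (verts G)"])
      (use assms(1) in \<open>auto simp: independent_set_def\<close>)
  then show ?thesis
    unfolding independence_number_def using assms(2) by (intro Max_ge) auto
qed

section \<open>Adjacency and connectedness\<close>

lemma mycielskian_arc_iff [simp]:
  "(Orig u, Orig v) \<in> parcs (mycielskian G) \<longleftrightarrow> (u, v) \<in> parcs G"
  "(Orig u, Copy v) \<in> parcs (mycielskian G) \<longleftrightarrow> (u, v) \<in> parcs G"
  "(Copy u, Orig v) \<in> parcs (mycielskian G) \<longleftrightarrow> (u, v) \<in> parcs G"
  "(Copy u, Copy v) \<notin> parcs (mycielskian G)"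
  "(Copy u, Root) \<in> parcs (mycielskian G) \<longleftrightarrow> u \<in> pverts G"
  "(Root, Copy u) \<in> parcs (mycielskian G) \<longleftrightarrow> u \<in> pverts G"
  "(Orig u, Root) \<notin> parcs (mycielskian G)"
  "(Root, Orig u) \<notin> parcs (mycielskian G)"
  by (auto simp: mycielskian_def)

context pair_graph
begin

lemma wf_mycielskian: "wf_digraph (with_proj (mycielskian G))"
proof -
  interpret M: pair_graph "mycielskian G"
    by (rule pair_graph_mycielskian) (rule pair_graph)
  show ?thesis by unfold_locales
qed

lemma connected_arc_leaving:
  assumes conn: "Digraph_Component.connected (with_proj G)"
    and "u \<in> U" "u \<in> pverts G" "v \<notin> U" "v \<in> pverts G"
  obtains x y where "x \<in> U" "y \<notin> U" "(x, y) \<in> parcs G"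
proof -
  have "u \<rightarrow>\<^sup>*\<^bsub>mk_symmetric (with_proj G)\<^esub> v"
    using conn assms(3,5) by (auto simp: connected_def strongly_connected_def)
  then have "u \<rightarrow>\<^sup>*\<^bsub>with_proj G\<^esub> v"
    using reachable_mk_symmetric_eq[OF sym_arcs] by simp
  then have "\<exists>x y. x \<in> U \<and> y \<notin> U \<and> (x, y) \<in> parcs G"
    using \<open>u \<in> U\<close> \<open>v \<notin> U\<close>
  proof (induction rule: converse_reachable_induct)
    case (step x y)
    then show ?case by (cases "y \<in> U") auto
  qed simp
  then show ?thesis using that by blast
qed

lemma nonadjacent_pair_if_not_complete:
  assumes "\<not> complete_digraph (card (pverts G)) (with_proj G)"
  obtains u v where "u \<in> pverts G" "v \<in> pverts G" "u \<noteq> v" "(u, v) \<notin> parcs G"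
  using assms pair_finite_verts in_arcsD1 in_arcsD2 no_loops'
  unfolding complete_digraph_pair_def by fast

lemma independence_number_ge_2_if_not_complete:
  assumes "\<not> complete_digraph (card (pverts G)) (with_proj G)"
  shows "2 \<le> independence_number (with_proj G)"
proof -
  obtain u v where uv: "u \<in> pverts G" "v \<in> pverts G" "u \<noteq> v" "(u, v) \<notin> parcs G"
    using nonadjacent_pair_if_not_complete[OF assms] .
  then have "independent_set (with_proj G) {u, v}"
    using arcs_symmetric no_loops' by (auto simp: independent_set_def)
  then have "card {u, v} \<le> independence_number (with_proj G)"
    using pair_finite_verts by (intro card_le_independence_number) auto
  with uv show ?thesis by simp
qed

text \<open>
  Some closed neighbourhood \<open>N[u]\<close> is not everything, and an arc leaving it starts at a neighbour
  of \<open>u\<close>.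
\<close>

lemma induced_path_if_not_complete:
  assumes "Digraph_Component.connected (with_proj G)"
    and "\<not> complete_digraph (card (pverts G)) (with_proj G)"
  obtains u v w where "(u, v) \<in> parcs G" "(v, w) \<in> parcs G" "u \<noteq> w" "(u, w) \<notin> parcs G"
proof -
  obtain u t where ut: "u \<in> pverts G" "t \<in> pverts G" "u \<noteq> t" "(u, t) \<notin> parcs G"
    using nonadjacent_pair_if_not_complete[OF assms(2)] .
  obtain v w where "v \<in> insert u {v. (u, v) \<in> parcs G}" "w \<notin> insert u {v. (u, v) \<in> parcs G}"
      "(v, w) \<in> parcs G"
    by (rule connected_arc_leaving[OF assms(1), of u "insert u {v. (u, v) \<in> parcs G}" t])
      (use ut in auto)
  then show ?thesis using that by auto
qed

lemma maximum_independent_set_dominates: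
  assumes "independent_set (with_proj G) C" "card C = independence_number (with_proj G)"
    and "v \<in> pverts G" "v \<notin> C"
  obtains c where "c \<in> C" "(c, v) \<in> parcs G"
proof (rule ccontr)
  assume "\<not> thesis"
  then have "independent_set (with_proj G) (insert v C)"
    using assms(1,3) that arcs_symmetric no_loops'[of v v] by (auto simp: independent_set_def)
  then have "card (insert v C) \<le> independence_number (with_proj G)"
    using pair_finite_verts by (intro card_le_independence_number) auto
  moreover have "finite C"
    using assms(1) pair_finite_verts by (auto simp: independent_set_def intro: finite_subset)
  ultimately show False
    using assms(2,4) by simp
qed

section \<open>General position sets of the Mycielskian\<close>

lemma general_position_no_induced_path:
  assumes "general_position_set (with_proj (mycielskian G)) S"
    and "(a, b) \<in> parcs (mycielskian G)" "(b, c) \<in> parcs (mycielskian G)"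
    and "(a, c) \<notin> parcs (mycielskian G)" "a \<noteq> c" "a \<in> S" "b \<in> S" "c \<in> S"
  shows False
proof -
  interpret M: pair_graph "mycielskian G"
    by (rule pair_graph_mycielskian) (rule pair_graph)
  have "distinct [a, b, c]"
    using assms M.no_loops' by auto
  with assms have "shortest_path (with_proj (mycielskian G)) [a, b, c]"
    by (intro shortest_path_length_2 wf_mycielskian) auto
  then show False
    by (rule general_position_setD[OF assms(1), where T = "{a, b, c}"])
      (use assms \<open>distinct [a, b, c]\<close> in auto)
qed

text \<open>
  A vertex is not adjacent to its own copy, so the path \<open>u, v, u'\<close> along an edge \<open>uv\<close> is a geodesic.
\<close>

lemma general_position_copies_of_arc:
  assumes "general_position_set (with_proj (mycielskian G)) S"
    and "Orig u \<in> S" "Copy u \<in> S" "Orig v \<in> S"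
  shows "(u, v) \<notin> parcs G"
proof
  assume "(u, v) \<in> parcs G"
  then show False
    using general_position_no_induced_path[OF assms(1), of "Orig u" "Orig v" "Copy u"]
      assms no_loops' arcs_symmetric by auto
qed

text \<open>
  Two copies are never adjacent, so any common neighbour \<open>x\<close> lies on a geodesic \<open>v', x, w'\<close>.
\<close>

lemma general_position_unique_neighbour_copy:
  assumes "general_position_set (with_proj (mycielskian G)) S"
    and "Orig x \<in> S" "Copy v \<in> S" "Copy w \<in> S" "(x, v) \<in> parcs G" "(x, w) \<in> parcs G"
  shows "v = w"
  using general_position_no_induced_path[OF assms(1), of "Copy v" "Orig x" "Copy w"]
    assms arcs_symmetric by auto

text \<open>
  This is the case of equality in the bound \<open>n + \<alpha>\<close>. Maximality makes \<open>C\<close> a dominating set, so no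
  original outside \<open>C\<close> can be in \<open>S\<close> and every copy is; this turns the vertices of \<open>C\<close> into leaves, and
  two of these leaves end a geodesic of length two or three whose second vertex is a copy.
\<close>

lemma general_position_extremal_False:
  assumes conn: "Digraph_Component.connected (with_proj G)"
    and gps: "general_position_set (with_proj (mycielskian G)) S"
    and C_def: "C = {v. Orig v \<in> S \<and> Copy v \<in> S}"
    and cover: "\<And>v. v \<in> pverts G \<Longrightarrow> Orig v \<in> S \<or> Copy v \<in> S"
    and indep: "independent_set (with_proj G) C"
    and max: "card C = independence_number (with_proj G)"
    and two: "2 \<le> card C"
  shows False
proof -
  have CV: "C \<subseteq> pverts G"
    using indep by (auto simp: independent_set_def)
  have B: "Copy v \<in> S" if v: "v \<in> pverts G" for v
  proof (cases "v \<in> C")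
    case False
    then obtain c where "c \<in> C" "(c, v) \<in> parcs G"
      using maximum_independent_set_dominates[OF indep max v] by blast
    then have "Orig v \<notin> S"
      using general_position_copies_of_arc[OF gps] C_def by blast
    then show ?thesis using cover[OF v] by blast
  qed (simp add: C_def)
  have leaf: "v = w" if "c \<in> C" "(c, v) \<in> parcs G" "(c, w) \<in> parcs G" for c v w
    using general_position_unique_neighbour_copy[OF gps, of c v w] that B in_arcsD2
    by (auto simp: C_def)
  have nonadj: "(c, d) \<notin> parcs G" if "c \<in> C" "d \<in> C" for c d
    using indep that by (auto simp: independent_set_def)
  obtain x x2 where x: "x \<in> C" "x2 \<in> C" "x \<noteq> x2"
    using two by (auto simp: numeral_2_eq_2 card_le_Suc_iff)
  obtain y where xy: "(x, y) \<in> parcs G"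
    by (rule connected_arc_leaving[OF conn, of x "{x}" x2]) (use x CV in auto)
  then have yC: "y \<notin> C"
    using nonadj x by blast
  obtain w where yw: "(y, w) \<in> parcs G" and wx: "w \<noteq> x"
  proof -
    obtain p q where "p \<in> {x, y}" "q \<notin> {x, y}" "(p, q) \<in> parcs G"
      by (rule connected_arc_leaving[OF conn, of x "{x, y}" x2]) (use x CV yC in auto)
    moreover have "p \<noteq> x"
      using calculation leaf[OF x(1) xy, of q] by auto
    ultimately show ?thesis using that by auto
  qed
  have yS: "Copy y \<in> S"
    using B in_arcsD2[OF xy] by blast
  show False
  proof (cases "w \<in> C")
    case True
    then show False
      using general_position_no_induced_path[OF gps, of "Orig x" "Copy y" "Orig w"]
        x xy yw wx yS nonadj by (auto simp: C_def)
  next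
    case False
    then obtain z where z: "z \<in> C" "(z, w) \<in> parcs G"
      using maximum_independent_set_dominates[OF indep max in_arcsD2[OF yw]] by blast
    have "w \<noteq> y"
      using yw no_loops' by blast
    then have "z \<noteq> x"
      using leaf[OF x(1) xy, of w] z by auto
    have path: "shortest_path (with_proj (mycielskian G)) [Orig x, Copy y, Orig w, Orig z]"
    proof (rule shortest_path_length_3)
      \<comment> \<open>Both ends are leaves, attached to the different vertices \<open>y\<close> and \<open>w\<close>.\<close>
      show False if "Orig x \<rightarrow>\<^bsub>with_proj (mycielskian G)\<^esub> m"
        "m \<rightarrow>\<^bsub>with_proj (mycielskian G)\<^esub> Orig z" for m
        using that leaf[OF x(1) xy] leaf[OF z] arcs_symmetric \<open>w \<noteq> y\<close> by (cases m) auto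
    qed (use xy yw z x nonadj \<open>z \<noteq> x\<close> wx False arcs_symmetric in \<open>auto simp: wf_mycielskian\<close>)
    show False
      by (rule general_position_setD[OF gps path, where T = "{Orig x, Copy y, Orig z}"])
        (use x z yS \<open>z \<noteq> x\<close> in \<open>auto simp: C_def\<close>)
  qed
qed

lemma card_general_position_mycielskian_le:
  assumes conn: "Digraph_Component.connected (with_proj G)"
    and ncomp: "\<not> complete_digraph (card (pverts G)) (with_proj G)"
    and gps: "general_position_set (with_proj (mycielskian G)) S"
  shows "card S \<le> card (pverts G) + independence_number (with_proj G) - 1"
proof -
  define A where "A = {v. Orig v \<in> S}"
  define B where "B = {v. Copy v \<in> S}"
  let ?n = "card (pverts G)" and ?\<alpha> = "independence_number (with_proj G)"
  have \<alpha>: "2 \<le> ?\<alpha>"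
    using independence_number_ge_2_if_not_complete[OF ncomp] .
  have "S \<subseteq> pverts (mycielskian G)"
    using gps by (simp add: general_position_set_def)
  then have AV: "A \<subseteq> pverts G" and BV: "B \<subseteq> pverts G"
    by (auto simp: A_def B_def mycielskian_def)
  then have fin: "finite A" "finite B"
    using pair_finite_verts by (auto intro: finite_subset)
  have "s \<in> Orig ` A \<union> Copy ` B \<union> (S \<inter> {Root}) \<longleftrightarrow> s \<in> S" for s
    by (cases s) (auto simp: A_def B_def)
  then have "S = Orig ` A \<union> Copy ` B \<union> (S \<inter> {Root})"
    by blast
  then have "card S = card (Orig ` A \<union> Copy ` B \<union> (S \<inter> {Root}))"
    by simp
  also have "\<dots> = card (Orig ` A) + card (Copy ` B) + card (S \<inter> {Root})"
    using fin by (subst card_Un_disjoint; (subst card_Un_disjoint)?) auto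
  finally have S: "card S = card A + card B + card (S \<inter> {Root})"
    by (simp add: card_image inj_on_def)
  show ?thesis
  proof (cases "Root \<in> S")
    case True
    have "card B \<le> 1"
    proof -
      have "v = w" if "v \<in> B" "w \<in> B" for v w
        using general_position_no_induced_path[OF gps, of "Copy v" Root "Copy w"] that True BV
        by (auto simp: B_def)
      then show ?thesis
        using fin by (auto simp: card_le_Suc0_iff_eq)
    qed
    moreover have "A \<noteq> pverts G"
    proof
      assume all: "A = pverts G"
      obtain u v w where "(u, v) \<in> parcs G" "(v, w) \<in> parcs G" "u \<noteq> w" "(u, w) \<notin> parcs G"
        using induced_path_if_not_complete[OF conn ncomp] .
      moreover from this have "u \<in> A" "v \<in> A" "w \<in> A"
        using all in_arcsD1 in_arcsD2 by auto
      ultimately show False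
        using general_position_no_induced_path[OF gps, of "Orig u" "Orig v" "Orig w"]
        by (auto simp: A_def)
    qed
    then have "card A < ?n"
      using AV pair_finite_verts by (intro psubset_card_mono) auto
    ultimately show ?thesis
      using S True \<alpha> by simp
  next
    case False
    have C_def: "A \<inter> B = {v. Orig v \<in> S \<and> Copy v \<in> S}"
      by (auto simp: A_def B_def)
    have indep: "independent_set (with_proj G) (A \<inter> B)"
      using general_position_copies_of_arc[OF gps] AV
      by (auto simp: independent_set_def A_def B_def)
    have C: "card (A \<inter> B) \<le> ?\<alpha>"
      using pair_finite_verts indep by (intro card_le_independence_number) auto
    have U: "card (A \<union> B) \<le> ?n"
      using AV BV pair_finite_verts by (intro card_mono) auto
    have "\<not> (card (A \<inter> B) = ?\<alpha> \<and> card (A \<union> B) = ?n)"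
    proof
      assume eq: "card (A \<inter> B) = ?\<alpha> \<and> card (A \<union> B) = ?n"
      then have "A \<union> B = pverts G"
        using AV BV pair_finite_verts by (intro card_subset_eq) auto
      then have "Orig v \<in> S \<or> Copy v \<in> S" if "v \<in> pverts G" for v
        using that by (auto simp: A_def B_def)
      then show False
        using general_position_extremal_False[OF conn gps C_def _ indep] eq \<alpha> by auto
    qed
    moreover have "card S = card (A \<union> B) + card (A \<inter> B)"
      using S False card_Un_Int[OF fin] by simp
    ultimately show ?thesis
      using C U \<alpha> by linarith
  qed
qed

end

theorem corollary18:
  fixes G :: "'a pair_pre_digraph"
  assumes "pair_graph G"
    and "Digraph_Component.connected (with_proj G)"
    and "\<not> complete_digraph (card (pverts G)) (with_proj G)"
  shows "gp (with_proj (mycielskian G))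
           \<le> card (pverts G) + independence_number (with_proj G) - 1"
proof (rule gp_leI)
  interpret M: pair_graph "mycielskian G"
    using assms(1) by (rule pair_graph_mycielskian)
  show "finite (verts (with_proj (mycielskian G)))"
    using M.pair_finite_verts by simp
qed (rule pair_graph.card_general_position_mycielskian_le[OF assms])

end
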